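(* Let $N_0\ge1$ and $j>0$. (a) For every $T$ with $1\le T\le N_0$, the operator $\boldsymbol{K}\boldsymbol{S}$ acting on probability vectors of the $T$-sector has a unique stationary distribution $\vec P^{[\infty]}(T)$, and $(\boldsymbol{K}\boldsymbol{S})^{\ell}\vec P\to\vec P^{[\infty]}(T)$ as $\ell\to\infty$ for every initial probability vector $\vec P$ of the $T$-sector. For every $T$ with $0\le T\le N_0-1$, the operator $\boldsymbol{S}\boldsymbol{K}$ acting on probability vectors of the $T$-sector has a unique stationary distribution $\vec Q^{[\infty]}(T)$, and $(\boldsymbol{S}\boldsymbol{K})^{\ell}\vec Q\to\vec Q^{[\infty]}(T)$ as $\ell\to\infty$ for every initial probability vector $\vec Q$ of the $T$-sector. (b) These stationary distributions coincide with the distribution of progressive quenching started from $M_0=0$: $$\vec P^{[\infty]}(T)=\vec Q^{[\infty]}(T)=\vec P^{(PQ)}(T)$$ (for $\vec P^{[\infty]}$ when $1\le T\le N_0$, for $\vec Q^{[\infty]}$ when $0\le T\le N_0-1$). (c) With the convention $\vec P^{[\infty]}(0)=\vec P^{(PQ)}(0)=(1)$, for all $1\le T\le N_0$, $$\boldsymbol{K}\vec P^{[\infty]}(T-1)=\vec P^{[\infty]}(T),\qquad \boldsymbol{S}\vec P^{[\infty]}(T)=\vec P^{[\infty]}(T-1).$$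
   Context: Model. $N_0$ Ising spins $s_i\in\{-1,+1\}$ sit on the complete graph with energy (inverse temperature absorbed) $H=-\frac{j}{N_0}\sum_{1\le i<k\le N_0}s_is_k$. For $0\le T\le N_0-1$ and $M\in\{-T,-T+2,\dots,T\}$, suppose that $T$ spins are quenched (frozen) with sum $M$; the $N=N_0-T$ unquenched spins $\sigma_1,\dots,\sigma_N$ are then in equilibrium with probability proportional to $$\exp\Big(\tfrac{j}{N_0}\sum_{1\le i<k\le N}\sigma_i\sigma_k+\tfrac{jM}{N_0}\sum_{i=1}^{N}\sigma_i\Big),\qquad \sigma\in\{-1,1\}^N,$$ and $m^{(\mathrm{eq})}_{T,M}$ denotes the expectation of $\sigma_1$ (equivalently, of any one unquenched spin) under this distribution. Sectors and operators. A probability vector of the $T$-sector is a probability distribution $\vec P(T)=(P(T,M))_{M\in\{-T,-T+2,\dots,T\}}$; put $P(T,M)=0$ for other $M$. Single-step quenching $\boldsymbol{K}$ maps the $(T-1)$-sector to the $T$-sector ($1\le T\le N_0$): from $M$ at stage $T-1$ one moves to $M\pm1$ at stage $T$ with probability $\frac{1\pm m^{(\mathrm{eq})}_{T-1,M}}{2}$. Thus $$(\boldsymbol{K}\vec P(T-1))_M=P(T-1,M-1)\tfrac{1+m^{(\mathrm{eq})}_{T-1,M-1}}{2}+P(T-1,M+1)\tfrac{1-m^{(\mathrm{eq})}_{T-1,M+1}}{2},$$ where terms with $P(T-1,\cdot)=0$ outside the sector are zero. Single-step unquenching $\boldsymbol{S}$ maps the $T$-sector to the $(T-1)$-sector ($1\le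 T\le N_0$): a uniformly random one of the $T$ quenched spins is released, so from $M$ at stage $T$ one moves to $M-1$ with probability $\frac12(1+\frac MT)$ and to $M+1$ with probability $\frac12(1-\frac MT)$. Recycled quenching is the iteration of $\boldsymbol{K}\boldsymbol{S}$ ($\boldsymbol S$ first) or of $\boldsymbol{S}\boldsymbol{K}$ ($\boldsymbol K$ first). A stationary distribution of such an operator is a probability vector fixed by it. Progressive quenching (PQ). $\vec P^{(PQ)}(0)=(1)$ (i.e. $M_0=0$), and $\vec P^{(PQ)}(T)=\boldsymbol{K}\vec P^{(PQ)}(T-1)$ for $1\le T\le N_0$. *)

theory Defs
  imports Complex_Main "HOL-Library.FuncSet"
begin

text \<open>
  Vectors \<open>(P(T,M))\<close> of the \<open>T\<close>-sector are functions of type \<^typ>\<open>int \<Rightarrow> real\<close> that vanish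
  outside the sector. Spins are real-valued so that they can be used directly in the energy.
\<close>

definition spin_configs :: "nat \<Rightarrow> (nat \<Rightarrow> real) set" where
  "spin_configs N = {1..N} \<rightarrow>\<^sub>E {-1, 1}"

definition boltzmann_weight :: "real \<Rightarrow> nat \<Rightarrow> nat \<Rightarrow> int \<Rightarrow> (nat \<Rightarrow> real) \<Rightarrow> real" where
  "boltzmann_weight j N0 T M \<sigma> =
     (let N = N0 - T in
      exp (j / real N0 * (\<Sum>i=1..N. \<Sum>k\<in>{i<..N}. \<sigma> i * \<sigma> k)
           + j * real_of_int M / real N0 * (\<Sum>i=1..N. \<sigma> i)))"

definition eq_expectation ::
  "real \<Rightarrow> nat \<Rightarrow> nat \<Rightarrow> int \<Rightarrow> ((nat \<Rightarrow> real) \<Rightarrow> real) \<Rightarrow> real" where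
  "eq_expectation j N0 T M f =
     (\<Sum>\<sigma>\<in>spin_configs (N0 - T). f \<sigma> * boltzmann_weight j N0 T M \<sigma>)
     / (\<Sum>\<sigma>\<in>spin_configs (N0 - T). boltzmann_weight j N0 T M \<sigma>)"

text \<open>Only meaningful for \<open>T < N0\<close>, when there is an unquenched spin.\<close>

definition m_eq :: "real \<Rightarrow> nat \<Rightarrow> nat \<Rightarrow> int \<Rightarrow> real" where
  "m_eq j N0 T M = eq_expectation j N0 T M (\<lambda>\<sigma>. \<sigma> 1)"

definition sector :: "nat \<Rightarrow> int set" where
  "sector T = (\<lambda>k. 2 * int k - int T) ` {0..T}"

definition prob_vector :: "nat \<Rightarrow> (int \<Rightarrow> real) \<Rightarrow> bool" where
  "prob_vector T P \<longleftrightarrow>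
     (\<forall>M. 0 \<le> P M) \<and> (\<forall>M. M \<notin> sector T \<longrightarrow> P M = 0) \<and> (\<Sum>M\<in>sector T. P M) = 1"

text \<open>
  Both single-step operators are indexed by their source sector: \<open>quench j N0 T\<close> maps the
  \<open>T\<close>-sector to the \<open>(T + 1)\<close>-sector (\<open>T < N0\<close>), and \<open>unquench T\<close> maps the \<open>T\<close>-sector to the
  \<open>(T - 1)\<close>-sector (\<open>1 \<le> T\<close>).
\<close>

definition quench :: "real \<Rightarrow> nat \<Rightarrow> nat \<Rightarrow> (int \<Rightarrow> real) \<Rightarrow> int \<Rightarrow> real" where
  "quench j N0 T P = (\<lambda>M.
     P (M - 1) * ((1 + m_eq j N0 T (M - 1)) / 2) + P (M + 1) * ((1 - m_eq j N0 T (M + 1)) / 2))"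

definition unquench :: "nat \<Rightarrow> (int \<Rightarrow> real) \<Rightarrow> int \<Rightarrow> real" where
  "unquench T P = (\<lambda>M.
     P (M + 1) * (1/2 * (1 + real_of_int (M + 1) / real T))
     + P (M - 1) * (1/2 * (1 - real_of_int (M - 1) / real T)))"

definition KS :: "real \<Rightarrow> nat \<Rightarrow> nat \<Rightarrow> (int \<Rightarrow> real) \<Rightarrow> int \<Rightarrow> real" where
  "KS j N0 T P = quench j N0 (T - 1) (unquench T P)"

definition SK :: "real \<Rightarrow> nat \<Rightarrow> nat \<Rightarrow> (int \<Rightarrow> real) \<Rightarrow> int \<Rightarrow> real" where
  "SK j N0 T P = unquench (T + 1) (quench j N0 T P)"

definition stationary :: "((int \<Rightarrow> real) \<Rightarrow> int \<Rightarrow> real) \<Rightarrow> nat \<Rightarrow> (int \<Rightarrow> real) \<Rightarrow> bool" where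
  "stationary A T P \<longleftrightarrow> prob_vector T P \<and> A P = P"

primrec PQ :: "real \<Rightarrow> nat \<Rightarrow> nat \<Rightarrow> int \<Rightarrow> real" where
  "PQ j N0 0 = (\<lambda>M. if M = 0 then 1 else 0)"
| "PQ j N0 (Suc T) = quench j N0 T (PQ j N0 T)"

text \<open>
  The definite descriptions below denote the stationary distributions once these are known
  to exist uniquely. \<open>KS\<close> does not act on the \<open>0\<close>-sector; the value at \<open>T = 0\<close> is a convention.
\<close>

definition P_inf :: "real \<Rightarrow> nat \<Rightarrow> nat \<Rightarrow> int \<Rightarrow> real" where
  "P_inf j N0 T = (if T = 0 then PQ j N0 0 else (THE P. stationary (KS j N0 T) T P))"

definition Q_inf :: "real \<Rightarrow> nat \<Rightarrow> nat \<Rightarrow> int \<Rightarrow> real" where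
  "Q_inf j N0 T = (THE Q. stationary (SK j N0 T) T Q)"

end

(*
  Write w(x) = exp (j x^2 / (2 N0)). Completing the square turns the equilibrium of the
  unquenched spins into the w-weighted law of a walk with N0 - T steps of size 1 started at M,
  so (1 + m_eq)/2 is a quotient of partition functions Z(N0-T-1, M+1) / Z(N0-T, M). Hence
  PQ(T, M) = g(T, M) Z(N0-T, M) / Z(N0, 0), with g the number of walks from 0 to M, and the
  classical identity (T + M) g(T, M) = 2 T g(T-1, M-1) gives S PQ(T) = PQ(T-1). So PQ is
  stationary for both K S and S K. Each of these chains can move between any two states of its
  sector in T + 1 steps, which yields a Doeblin minorization by PQ and geometric convergence;
  uniqueness follows from convergence.
*)
theory Submission
  imports Defs
begin

section \<open>Signed walks and spin sums\<close>

text \<open>Sum of \<open>f\<close> over the endpoints of all \<open>n\<close>-step walks from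
  \<open>x\<close> with steps +1 and -1. The ring type admits real starting points for spin sums and
  integer ones for counting walks.\<close>

primrec walk_sum :: "('a::ring_1 \<Rightarrow> real) \<Rightarrow> nat \<Rightarrow> 'a \<Rightarrow> real" where
  "walk_sum f 0 x = f x"
| "walk_sum f (Suc n) x = walk_sum f n (x + 1) + walk_sum f n (x - 1)"

lemma walk_sum_pos: "(\<And>x. f x > 0) \<Longrightarrow> walk_sum f n x > 0"
  by (induction n arbitrary: x) (auto intro: add_pos_pos)

lemma sum_PiE_insert:
  fixes F :: "('a \<Rightarrow> real) \<Rightarrow> real"
  assumes "finite A" "a \<notin> A"
  shows "(\<Sum>\<sigma>\<in>insert a A \<rightarrow>\<^sub>E {-1, 1}. F \<sigma>)
       = (\<Sum>\<sigma>\<in>A \<rightarrow>\<^sub>E {-1, 1}. F (\<sigma>(a := 1)) + F (\<sigma>(a := -1)))"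
proof -
  let ?S = "{-1, 1::real}"
  have inj: "inj_on (\<lambda>(y, g). g(a := y)) (?S \<times> (A \<rightarrow>\<^sub>E ?S))"
    using assms(2) by (rule inj_combinator)
  have "(\<Sum>\<sigma>\<in>insert a A \<rightarrow>\<^sub>E ?S. F \<sigma>) = (\<Sum>(y, g)\<in>?S \<times> (A \<rightarrow>\<^sub>E ?S). F (g(a := y)))"
    unfolding PiE_insert_eq by (subst sum.reindex[OF inj]) (simp add: case_prod_unfold)
  also have "\<dots> = (\<Sum>y\<in>?S. \<Sum>g\<in>A \<rightarrow>\<^sub>E ?S. F (g(a := y)))"
    by (rule sum.cartesian_product[symmetric])
  finally show ?thesis
    by (simp add: sum.distrib)
qed

lemma sum_fun_upd_outside: "a \<notin> A \<Longrightarrow> sum (\<sigma>(a := y)) A = sum \<sigma> A"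
  by (rule sum.cong) auto

text \<open>Each spin is one step of a walk started at \<open>x\<close>. The start stays arbitrary
  in the induction because the spin at the inserted \<open>a\<close> shifts it.\<close>

lemma sum_PiE_eq_walk_sum:
  fixes f :: "real \<Rightarrow> real"
  assumes "finite A"
  shows "(\<Sum>\<sigma>\<in>A \<rightarrow>\<^sub>E {-1, 1}. f (x + (\<Sum>i\<in>A. \<sigma> i))) = walk_sum f (card A) x"
  using assms
proof (induction A arbitrary: x rule: finite_induct)
  case empty
  then show ?case by simp
next
  case (insert a A)
  have "(\<Sum>\<sigma>\<in>insert a A \<rightarrow>\<^sub>E {-1, 1}. f (x + (\<Sum>i\<in>insert a A. \<sigma> i)))
      = (\<Sum>\<sigma>\<in>A \<rightarrow>\<^sub>E {-1, 1}. f ((x + 1) + (\<Sum>i\<in>A. \<sigma> i)) + f ((x - 1) + (\<Sum>i\<in>A. \<sigma> i)))"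
    using insert.hyps
    by (subst sum_PiE_insert) (simp_all add: sum_fun_upd_outside fun_upd_same algebra_simps del: fun_upd_apply)
  then show ?case
    using insert by (simp add: sum.distrib)
qed

text \<open>With the spin at \<open>a\<close> taken as the first step, its value is the sign of the
  corresponding branch. For \<open>a = 1\<close> this yields the numerator of the
  magnetization.\<close>

lemma sum_PiE_spin_eq_walk_sum:
  fixes f :: "real \<Rightarrow> real"
  assumes "finite A" "a \<notin> A"
  shows "(\<Sum>\<sigma>\<in>insert a A \<rightarrow>\<^sub>E {-1, 1}. \<sigma> a * f (x + (\<Sum>i\<in>insert a A. \<sigma> i)))
       = walk_sum f (card A) (x + 1) - walk_sum f (card A) (x - 1)"
proof -
  have "(\<Sum>\<sigma>\<in>insert a A \<rightarrow>\<^sub>E {-1, 1}. \<sigma> a * f (x + (\<Sum>i\<in>insert a A. \<sigma> i)))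
      = (\<Sum>\<sigma>\<in>A \<rightarrow>\<^sub>E {-1, 1}. f ((x + 1) + (\<Sum>i\<in>A. \<sigma> i)) - f ((x - 1) + (\<Sum>i\<in>A. \<sigma> i)))"
    using assms
    by (subst sum_PiE_insert) (simp_all add: sum_fun_upd_outside fun_upd_same algebra_simps del: fun_upd_apply)
  then show ?thesis
    using assms by (simp add: sum_subtractf sum_PiE_eq_walk_sum)
qed

section \<open>The equilibrium magnetization\<close>

text \<open>In the expanded square of the total each pair occurs twice, and the diagonal contributes
  \<open>N\<close> because spins square to 1.\<close>

lemma sum_pairs_eq_square:
  fixes \<sigma> :: "nat \<Rightarrow> real"
  assumes "\<And>i. i \<in> {1..N} \<Longrightarrow> \<sigma> i \<in> {-1, 1}"
  shows "(\<Sum>i=1..N. \<Sum>k\<in>{i<..N}. \<sigma> i * \<sigma> k) = ((\<Sum>i=1..N. \<sigma> i)\<^sup>2 - real N) / 2"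
  using assms
proof (induction N)
  case 0
  then show ?case by simp
next
  case (Suc N)
  have "(\<Sum>k\<in>{i<..Suc N}. \<sigma> i * \<sigma> k) = (\<Sum>k\<in>{i<..N}. \<sigma> i * \<sigma> k) + \<sigma> i * \<sigma> (Suc N)"
    if "i \<in> {1..N}" for i
  proof -
    have "{i<..Suc N} = insert (Suc N) {i<..N}" using that by auto
    then show ?thesis by simp
  qed
  then have "(\<Sum>i=1..Suc N. \<Sum>k\<in>{i<..Suc N}. \<sigma> i * \<sigma> k)
      = (\<Sum>i=1..N. \<Sum>k\<in>{i<..N}. \<sigma> i * \<sigma> k) + (\<Sum>i=1..N. \<sigma> i) * \<sigma> (Suc N)"
    by (simp add: sum.distrib sum_distrib_right)
  moreover have "(\<sigma> (Suc N))\<^sup>2 = 1"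
    using Suc.prems[of "Suc N"] by auto
  ultimately show ?case
    using Suc by (simp add: power2_sum field_simps)
qed

text \<open>Here \<open>x\<close> stands for the total magnetization of all spins, quenched and
  unquenched.\<close>

definition gauss_weight :: "real \<Rightarrow> nat \<Rightarrow> real \<Rightarrow> real" where
  "gauss_weight j N0 x = exp (j / (2 * real N0) * x\<^sup>2)"

text \<open>Up to a prefactor independent of the configuration, the normalizing sum for
  \<open>N\<close> unquenched spins when the quenched ones sum to \<open>M\<close>.\<close>

definition partition_fun :: "real \<Rightarrow> nat \<Rightarrow> nat \<Rightarrow> int \<Rightarrow> real" where
  "partition_fun j N0 N M = walk_sum (gauss_weight j N0) N (real_of_int M)"

lemma partition_fun_pos: "partition_fun j N0 N M > 0"
  unfolding partition_fun_def by (rule walk_sum_pos) (simp add: gauss_weight_def)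

lemma partition_fun_Suc:
  "partition_fun j N0 (Suc N) M = partition_fun j N0 N (M + 1) + partition_fun j N0 N (M - 1)"
  by (simp add: partition_fun_def)

text \<open>Completing the square: the cross term is the field energy, and the squared spin sum
  carries the pair interaction. The prefactor does not involve \<open>\<sigma>\<close>, so it
  cancels in expectations.\<close>

lemma boltzmann_weight_eq:
  assumes "\<sigma> \<in> {1..N0 - T} \<rightarrow>\<^sub>E {-1, 1}" "N0 > 0"
  shows "boltzmann_weight j N0 T M \<sigma>
       = exp (- j / (2 * real N0) * ((real_of_int M)\<^sup>2 + real (N0 - T)))
         * gauss_weight j N0 (real_of_int M + (\<Sum>i=1..N0 - T. \<sigma> i))"
proof -
  have "(\<Sum>i=1..N0 - T. \<Sum>k\<in>{i<..N0 - T}. \<sigma> i * \<sigma> k)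
      = ((\<Sum>i=1..N0 - T. \<sigma> i)\<^sup>2 - real (N0 - T)) / 2"
    using assms(1) by (intro sum_pairs_eq_square) (auto simp: PiE_iff)
  then show ?thesis
    unfolding boltzmann_weight_def gauss_weight_def Let_def exp_add[symmetric]
    using assms(2) by (simp only: power2_sum) (simp add: field_simps)
qed

lemma m_eq_eq_partition_fun:
  assumes "T < N0"
  shows "m_eq j N0 T M = (partition_fun j N0 (N0 - Suc T) (M + 1)
           - partition_fun j N0 (N0 - Suc T) (M - 1)) / partition_fun j N0 (N0 - T) M"
proof -
  define N where "N = N0 - T"
  \<comment> \<open>Spin 1, which exists since \<open>T < N0\<close>, is split off so that it can
    serve as the first step of the walk.\<close>
  have N: "{1..N} = insert 1 {2..N}" "N0 - Suc T = card {2..N}"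
    using assms by (auto simp: N_def)
  define c where "c = exp (- j / (2 * real N0) * ((real_of_int M)\<^sup>2 + real N))"
  have bw: "boltzmann_weight j N0 T M \<sigma>
      = c * gauss_weight j N0 (real_of_int M + (\<Sum>i=1..N. \<sigma> i))"
    if "\<sigma> \<in> {1..N} \<rightarrow>\<^sub>E {-1, 1}" for \<sigma>
    using boltzmann_weight_eq[of \<sigma> N0 T j M] that assms by (simp add: N_def c_def)
  have "(\<Sum>\<sigma>\<in>{1..N} \<rightarrow>\<^sub>E {-1, 1}. boltzmann_weight j N0 T M \<sigma>) = c * partition_fun j N0 N M"
    using sum_PiE_eq_walk_sum[of "{1..N}" "gauss_weight j N0" "real_of_int M"]
    by (simp add: bw partition_fun_def flip: sum_distrib_left)
  moreover have "(\<Sum>\<sigma>\<in>{1..N} \<rightarrow>\<^sub>E {-1, 1}. \<sigma> 1 * boltzmann_weight j N0 T M \<sigma>)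
      = c * (\<Sum>\<sigma>\<in>{1..N} \<rightarrow>\<^sub>E {-1, 1}. \<sigma> 1 * gauss_weight j N0 (real_of_int M + (\<Sum>i=1..N. \<sigma> i)))"
    by (simp add: bw sum_distrib_left mult_ac)
  moreover have "(\<Sum>\<sigma>\<in>{1..N} \<rightarrow>\<^sub>E {-1, 1}. \<sigma> 1 * gauss_weight j N0 (real_of_int M + (\<Sum>i=1..N. \<sigma> i)))
      = partition_fun j N0 (N0 - Suc T) (M + 1) - partition_fun j N0 (N0 - Suc T) (M - 1)"
    unfolding N
    using sum_PiE_spin_eq_walk_sum[of "{2..N}" 1 "gauss_weight j N0" "real_of_int M"]
    by (simp add: partition_fun_def)
  moreover have "c > 0"
    by (simp add: c_def)
  ultimately show ?thesis
    by (simp add: m_eq_def eq_expectation_def spin_configs_def flip: N_def)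
qed

text \<open>Quenching is a simple walk reweighted by the partition function of the remaining spins
  (a Doob transform), so that factors telescope along \<open>PQ\<close>.\<close>

lemma flip_prob_eq_partition_fun:
  assumes "T < N0"
  shows "(1 + m_eq j N0 T M) / 2 = partition_fun j N0 (N0 - Suc T) (M + 1) / partition_fun j N0 (N0 - T) M"
    and "(1 - m_eq j N0 T M) / 2 = partition_fun j N0 (N0 - Suc T) (M - 1) / partition_fun j N0 (N0 - T) M"
proof -
  \<comment> \<open>The denominator of \<open>m_eq\<close> is the sum of the two terms whose
    difference is its numerator, so \<open>1 + m_eq\<close> and \<open>1 - m_eq\<close> each keep
    twice one term.\<close>
  have "partition_fun j N0 (N0 - T) M
      = partition_fun j N0 (N0 - Suc T) (M + 1) + partition_fun j N0 (N0 - Suc T) (M - 1)"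
    using assms by (simp add: Suc_diff_Suc flip: partition_fun_Suc)
  moreover have "partition_fun j N0 (N0 - T) M > 0"
    by (rule partition_fun_pos)
  ultimately show
    "(1 + m_eq j N0 T M) / 2 = partition_fun j N0 (N0 - Suc T) (M + 1) / partition_fun j N0 (N0 - T) M"
    "(1 - m_eq j N0 T M) / 2 = partition_fun j N0 (N0 - Suc T) (M - 1) / partition_fun j N0 (N0 - T) M"
    unfolding m_eq_eq_partition_fun[OF assms] by (simp_all add: field_simps)
qed

lemma abs_m_eq_less_1:
  assumes "T < N0"
  shows "\<bar>m_eq j N0 T M\<bar> < 1"
proof -
  have "(1 + m_eq j N0 T M) / 2 > 0" "(1 - m_eq j N0 T M) / 2 > 0"
    unfolding flip_prob_eq_partition_fun[OF assms] by (simp_all add: partition_fun_pos)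
  then show ?thesis by (simp add: abs_less_iff)
qed

section \<open>Progressive quenching\<close>

text \<open>Number of \<open>T\<close>-step walks from \<open>M\<close> to 0, equally from 0 to
  \<open>M\<close>: a binomial coefficient on the sector and 0 elsewhere.\<close>

definition walk_count :: "nat \<Rightarrow> int \<Rightarrow> real" where
  "walk_count = walk_sum (\<lambda>M. if M = 0 then 1 else 0)"

lemma walk_count_0: "walk_count 0 M = (if M = 0 then 1 else 0)"
  and walk_count_Suc: "walk_count (Suc T) M = walk_count T (M + 1) + walk_count T (M - 1)"
  by (simp_all add: walk_count_def)

text \<open>The ratio of neighbouring binomial coefficients, cross-multiplied so that it holds for
  all integers \<open>M\<close>. The step adds the hypotheses at \<open>M + 1\<close> and
  \<open>M - 1\<close>.\<close>

lemma walk_count_ratio: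
  "(real T + 1 + real_of_int M) * walk_count T (M + 1) = (real T + 1 - real_of_int M) * walk_count T (M - 1)"
proof (induction T arbitrary: M)
  case 0
  show ?case by (auto simp: walk_count_0 eq_neg_iff_add_eq_0)
next
  case (Suc T)
  show ?case
    using Suc[of "M + 1"] Suc[of "M - 1"] by (simp add: walk_count_Suc algebra_simps)
qed

text \<open>The steps of a walk are exchangeable, so the fraction of up-steps in a walk ending at
  \<open>M\<close> is the fraction of such walks whose last step is up; likewise for
  down-steps.\<close>

lemma walk_count_release:
  "walk_count (Suc T) M * (1/2 * (1 + real_of_int M / real (Suc T))) = walk_count T (M - 1)"
  "walk_count (Suc T) M * (1/2 * (1 - real_of_int M / real (Suc T))) = walk_count T (M + 1)"
  using walk_count_ratio[of T M]
  by (simp_all add: walk_count_Suc divide_simps) (simp_all add: algebra_simps)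

text \<open>Each quenching step cancels the partition function left by the previous one and installs
  the next; summing over histories counts walks.\<close>

lemma PQ_eq:
  assumes "T \<le> N0"
  shows "PQ j N0 T M = walk_count T M * partition_fun j N0 (N0 - T) M / partition_fun j N0 N0 0"
  using assms
proof (induction T arbitrary: M)
  case 0
  show ?case
    using partition_fun_pos[of j N0 N0 0] by (simp add: walk_count_0)
next
  case (Suc T)
  have "partition_fun j N0 (N0 - T) (M - 1) \<noteq> 0" "partition_fun j N0 (N0 - T) (M + 1) \<noteq> 0"
    by (simp_all add: partition_fun_pos less_imp_neq[THEN not_sym])
  then show ?case
    using Suc by (simp add: quench_def flip_prob_eq_partition_fun walk_count_Suc field_simps flip: add_divide_distrib)
qed

text \<open>Release turns both walk counts into \<open>walk_count T M\<close>, and the two remaining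
  partition functions add up by their recursion. This makes \<open>PQ\<close> stationary for both
  recycled operators.\<close>

lemma unquench_PQ:
  assumes "T < N0"
  shows "unquench (Suc T) (PQ j N0 (Suc T)) = PQ j N0 T"
proof
  fix M
  let ?Z = "partition_fun j N0"
  have "unquench (Suc T) (PQ j N0 (Suc T)) M
      = ((walk_count (Suc T) (M + 1) * (1/2 * (1 + real_of_int (M + 1) / real (Suc T)))) * ?Z (N0 - Suc T) (M + 1)
       + (walk_count (Suc T) (M - 1) * (1/2 * (1 - real_of_int (M - 1) / real (Suc T)))) * ?Z (N0 - Suc T) (M - 1))
        / ?Z N0 0"
    using assms by (simp only: unquench_def PQ_eq Suc_leI add_divide_distrib times_divide_eq_left times_divide_eq_right mult_ac)
  also have "\<dots> = walk_count T M * (?Z (N0 - Suc T) (M + 1) + ?Z (N0 - Suc T) (M - 1)) / ?Z N0 0"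
    unfolding walk_count_release by (simp add: distrib_left)
  also have "\<dots> = PQ j N0 T M"
    using assms by (simp add: PQ_eq Suc_diff_Suc flip: partition_fun_Suc)
  finally show "unquench (Suc T) (PQ j N0 (Suc T)) M = PQ j N0 T M" .
qed

section \<open>Probability vectors\<close>

lemma mem_sector_iff: "M \<in> sector T \<longleftrightarrow> \<bar>M\<bar> \<le> int T \<and> even (M + int T)"
proof
  assume R: "\<bar>M\<bar> \<le> int T \<and> even (M + int T)"
  then obtain k where k: "M + int T = 2 * k" by (blast elim: evenE)
  then have "M = 2 * int (nat k) - int T" "nat k \<in> {0..T}" using R by auto
  then show "M \<in> sector T" unfolding sector_def by blast
qed (auto simp: sector_def)

lemma finite_sector [simp]: "finite (sector T)"
  by (simp add: sector_def)

lemma card_sector: "card (sector T) = Suc T"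
  unfolding sector_def by (subst card_image) (auto simp: inj_on_def)

lemma sector_Suc_iff: "M \<in> sector (Suc T) \<longleftrightarrow> M - 1 \<in> sector T \<or> M + 1 \<in> sector T"
  unfolding mem_sector_iff by (auto simp: even_add) presburger+

lemma sector_step:
  assumes "M \<in> sector T"
  shows "M + 1 \<in> sector (Suc T)" "M - 1 \<in> sector (Suc T)"
  using assms by (simp_all add: sector_Suc_iff)

lemma sector_gap:
  assumes "M \<in> sector T" "M' \<in> sector T" "M < M'"
  shows "M + 2 \<le> M'"
proof -
  have "even (M + int T)" "even (M' + int T)"
    using assms by (simp_all add: mem_sector_iff)
  then show ?thesis using assms(3) by presburger
qed

text \<open>Neighbouring sectors are not translates of each other, so only the support of
  \<open>f\<close> is reindexed; all other terms vanish.\<close>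

lemma sum_shift:
  fixes f :: "int \<Rightarrow> real"
  assumes "finite X" "finite Y" "\<And>M. f M \<noteq> 0 \<Longrightarrow> M \<in> X \<and> M + d \<in> Y"
  shows "(\<Sum>M\<in>Y. f (M - d)) = (\<Sum>M\<in>X. f M)"
  by (rule sum.reindex_bij_witness_not_neutral
        [where S' = "{M\<in>Y. f (M - d) = 0}" and T' = "{M\<in>X. f M = 0}"
         and i = "\<lambda>M. M + d" and j = "\<lambda>M. M - d"])
    (use assms assms(3)[of "_ - d"] in auto)

section \<open>Conservation of probability under both operators\<close>

lemma prob_vector_nonneg: "prob_vector T P \<Longrightarrow> 0 \<le> P M"
  and prob_vector_outside: "prob_vector T P \<Longrightarrow> M \<notin> sector T \<Longrightarrow> P M = 0"
  and prob_vector_sum: "prob_vector T P \<Longrightarrow> (\<Sum>M\<in>sector T. P M) = 1"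
  by (simp_all add: prob_vector_def)

lemma prob_vector_le_1:
  assumes "prob_vector T P"
  shows "P M \<le> 1"
proof (cases "M \<in> sector T")
  case True
  then have "P M \<le> (\<Sum>M\<in>sector T. P M)"
    by (intro member_le_sum) (auto simp: prob_vector_nonneg[OF assms])
  then show ?thesis by (simp add: prob_vector_sum[OF assms])
qed (simp add: prob_vector_outside[OF assms])

lemma prob_vector_quench:
  assumes "T < N0" "prob_vector T P"
  shows "prob_vector (Suc T) (quench j N0 T P)"
proof -
  let ?a = "\<lambda>M. P M * ((1 + m_eq j N0 T M) / 2)" and ?b = "\<lambda>M. P M * ((1 - m_eq j N0 T M) / 2)"
  note P = prob_vector_nonneg[OF assms(2)] prob_vector_outside[OF assms(2)]
  have m: "0 \<le> 1 + m_eq j N0 T M" "0 \<le> 1 - m_eq j N0 T M" for M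
    using abs_m_eq_less_1[OF assms(1), of j M] by linarith+
  have supp: "P M \<noteq> 0 \<Longrightarrow> M \<in> sector T" for M
    using P(2) by blast
  have "(\<Sum>M\<in>sector (Suc T). quench j N0 T P M)
      = (\<Sum>M\<in>sector (Suc T). ?a (M - 1)) + (\<Sum>M\<in>sector (Suc T). ?b (M - (-1)))"
    by (simp add: quench_def sum.distrib)
  \<comment> \<open>Shifts by \<open>d = 1\<close> and \<open>d = -1\<close>; the latter is why
    \<open>M + 1\<close> was written as \<open>M - (-1)\<close>.\<close>
  also have "\<dots> = (\<Sum>M\<in>sector T. ?a M) + (\<Sum>M\<in>sector T. ?b M)"
    using supp sector_step by (subst (1 2) sum_shift[where X = "sector T"]) auto
  also have "\<dots> = (\<Sum>M\<in>sector T. P M)"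
    by (simp add: field_simps flip: sum.distrib)
  finally show ?thesis
    using P m prob_vector_sum[OF assms(2)]
    by (auto simp: prob_vector_def quench_def sector_Suc_iff intro!: add_nonneg_nonneg mult_nonneg_nonneg divide_nonneg_nonneg)
qed

lemma prob_vector_unquench:
  assumes "prob_vector (Suc T) P"
  shows "prob_vector T (unquench (Suc T) P)"
proof -
  let ?T = "real (Suc T)"
  let ?a = "\<lambda>M. P M * (1/2 * (1 + real_of_int M / ?T))" and ?b = "\<lambda>M. P M * (1/2 * (1 - real_of_int M / ?T))"
  note P = prob_vector_nonneg[OF assms] prob_vector_outside[OF assms]
  have abs_le: "\<bar>real_of_int M\<bar> \<le> ?T" if "M \<in> sector (Suc T)" for M
    using that unfolding mem_sector_iff by linarith
  have nonneg: "0 \<le> ?a M \<and> 0 \<le> ?b M" for M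
  proof (cases "M \<in> sector (Suc T)")
    case True
    then have "0 \<le> 1 + real_of_int M / ?T" "0 \<le> 1 - real_of_int M / ?T"
      using abs_le[of M] by (simp_all add: field_simps abs_le_iff del: of_nat_Suc)
    then show ?thesis
      using P(1)[of M] by (intro conjI mult_nonneg_nonneg) simp_all
  qed (simp add: P(2))
  \<comment> \<open>At \<open>M = - int (Suc T)\<close> the weight vanishes, which rules out the
    only move down that would leave the smaller sector.\<close>
  have a: "M - 1 \<in> sector T" and aS: "M \<in> sector (Suc T)" if "?a M \<noteq> 0" for M
  proof -
    show M: "M \<in> sector (Suc T)" using that P(2)[of M] by auto
    have "real_of_int M \<noteq> - ?T" using that by (auto simp del: of_nat_Suc)
    then have "M \<noteq> - int (Suc T)" by auto
    then show "M - 1 \<in> sector T" using M unfolding mem_sector_iff by (auto; presburger)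
  qed
  have b: "M + 1 \<in> sector T" and bS: "M \<in> sector (Suc T)" if "?b M \<noteq> 0" for M
  proof -
    show M: "M \<in> sector (Suc T)" using that P(2)[of M] by auto
    have "real_of_int M \<noteq> ?T" using that by (auto simp del: of_nat_Suc)
    then have "M \<noteq> int (Suc T)" by auto
    then show "M + 1 \<in> sector T" using M unfolding mem_sector_iff by (auto; presburger)
  qed
  have eq: "unquench (Suc T) P M = ?a (M - (-1)) + ?b (M - 1)" for M
    by (simp add: unquench_def)
  have "(\<Sum>M\<in>sector T. unquench (Suc T) P M) = (\<Sum>M\<in>sector (Suc T). ?a M) + (\<Sum>M\<in>sector (Suc T). ?b M)"
    unfolding eq sum.distrib
    by (rule arg_cong2[where f = "(+)"]; rule sum_shift) (use a aS b bS in auto)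
  also have "\<dots> = (\<Sum>M\<in>sector (Suc T). P M)"
    by (simp add: algebra_simps flip: sum.distrib)
  finally have "(\<Sum>M\<in>sector T. unquench (Suc T) P M) = 1"
    by (simp add: prob_vector_sum[OF assms])
  moreover have "unquench (Suc T) P M = 0" if "M \<notin> sector T" for M
    unfolding eq using a[of "M - (-1)"] b[of "M - 1"] that by fastforce
  moreover have "unquench (Suc T) P M \<ge> 0" for M
    unfolding eq using nonneg by (simp only: add_nonneg_nonneg)
  ultimately show ?thesis by (simp add: prob_vector_def)
qed

lemma prob_vector_PQ: "T \<le> N0 \<Longrightarrow> prob_vector T (PQ j N0 T)"
proof (induction T)
  case 0
  show ?case by (auto simp: prob_vector_def sector_def)
next
  case (Suc T)
  then show ?case by (simp add: prob_vector_quench)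
qed

section \<open>Convergence under a minorization condition\<close>

definition preserves_prob :: "nat \<Rightarrow> ((int \<Rightarrow> real) \<Rightarrow> int \<Rightarrow> real) \<Rightarrow> bool" where
  "preserves_prob T A \<longleftrightarrow> (\<forall>P. prob_vector T P \<longrightarrow> prob_vector T (A P))"

definition linear_op :: "((int \<Rightarrow> real) \<Rightarrow> int \<Rightarrow> real) \<Rightarrow> bool" where
  "linear_op A \<longleftrightarrow> (\<forall>a b P Q. A (\<lambda>M. a * P M + b * Q M) = (\<lambda>M. a * A P M + b * A Q M))"

lemma prob_vector_funpow:
  "preserves_prob T A \<Longrightarrow> prob_vector T P \<Longrightarrow> prob_vector T ((A ^^ l) P)"
  by (induction l) (auto simp: preserves_prob_def)

lemma linear_op_funpow: "linear_op A \<Longrightarrow> linear_op (A ^^ l)"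
  by (induction l) (auto simp: linear_op_def)

lemma funpow_fixpoint: "f x = x \<Longrightarrow> (f ^^ l) x = x"
  by (induction l) auto

lemma prob_vector_remainder:
  assumes "prob_vector T P" "prob_vector T R" "0 < e" "e < 1" "\<And>M. e * R M \<le> P M"
  shows "prob_vector T (\<lambda>M. (P M - e * R M) / (1 - e))"
proof -
  have "(\<Sum>M\<in>sector T. (P M - e * R M) / (1 - e)) = 1"
    using assms(4) prob_vector_sum[OF assms(1)] prob_vector_sum[OF assms(2)]
    by (simp add: sum_subtractf flip: sum_divide_distrib sum_distrib_left)
  then show ?thesis
    using assms by (auto simp: prob_vector_def)
qed

text \<open>Each block of \<open>n\<close> steps splits off a fraction \<open>e\<close> of the mass, distributed as the fixed
  vector \<open>R\<close>; what remains is again a multiple of a probability vector.\<close>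

lemma minorization_decomp:
  assumes A: "preserves_prob T A" "linear_op A" and R: "prob_vector T R" "A R = R"
    and e: "0 < e" "e < 1"
    and minor: "\<And>P M. prob_vector T P \<Longrightarrow> e * R M \<le> (A ^^ n) P M"
    and P: "prob_vector T P"
  shows "\<exists>Q. prob_vector T Q \<and>
    (A ^^ (k * n)) P = (\<lambda>M. (1 - e) ^ k * Q M + (1 - (1 - e) ^ k) * R M)"
proof (induction k)
  case 0
  show ?case using P by auto
next
  case (Suc k)
  then obtain Q where Q: "prob_vector T Q"
    "(A ^^ (k * n)) P = (\<lambda>M. (1 - e) ^ k * Q M + (1 - (1 - e) ^ k) * R M)" by blast
  define Q' where "Q' = (\<lambda>M. ((A ^^ n) Q M - e * R M) / (1 - e))"
  have "prob_vector T Q'"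
    unfolding Q'_def
    using prob_vector_funpow[OF A(1) Q(1)] R(1) e minor[OF Q(1)] by (rule prob_vector_remainder)
  moreover have "(A ^^ (Suc k * n)) P = (\<lambda>M. (1 - e) ^ Suc k * Q' M + (1 - (1 - e) ^ Suc k) * R M)"
  proof -
    have "(A ^^ (Suc k * n)) P = (A ^^ n) ((A ^^ (k * n)) P)"
      by (simp add: funpow_add)
    also have "\<dots> = (\<lambda>M. (1 - e) ^ k * (A ^^ n) Q M + (1 - (1 - e) ^ k) * R M)"
      using linear_op_funpow[OF A(2), of n] funpow_fixpoint[of A, OF R(2), of n]
      unfolding Q(2) by (simp add: linear_op_def)
    also have "\<dots> = (\<lambda>M. (1 - e) ^ Suc k * Q' M + (1 - (1 - e) ^ Suc k) * R M)"
    proof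
      fix M
      have "(A ^^ n) Q M = (1 - e) * Q' M + e * R M"
        using e by (simp add: Q'_def)
      then have "(1 - e) ^ k * (A ^^ n) Q M = (1 - e) ^ k * ((1 - e) * Q' M + e * R M)"
        by simp
      then show "(1 - e) ^ k * (A ^^ n) Q M + (1 - (1 - e) ^ k) * R M
          = (1 - e) ^ Suc k * Q' M + (1 - (1 - e) ^ Suc k) * R M"
        by (simp add: algebra_simps)
    qed
    finally show ?thesis .
  qed
  ultimately show ?case by blast
qed

text \<open>The \<open>l mod n\<close> leftover steps are run first; they only change the initial
  probability vector, and whole blocks of \<open>n\<close> steps follow.\<close>

lemma minorization_bound:
  assumes A: "preserves_prob T A" "linear_op A" and R: "prob_vector T R" "A R = R"
    and e: "0 < e" "e < 1"
    and minor: "\<And>P M. prob_vector T P \<Longrightarrow> e * R M \<le> (A ^^ n) P M"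
    and P: "prob_vector T P"
  shows "\<bar>(A ^^ l) P M - R M\<bar> \<le> (1 - e) ^ (l div n)"
proof -
  have P': "prob_vector T ((A ^^ (l mod n)) P)"
    by (rule prob_vector_funpow[OF A(1) P])
  obtain Q where Q: "prob_vector T Q"
    "(A ^^ (l div n * n)) ((A ^^ (l mod n)) P)
      = (\<lambda>M. (1 - e) ^ (l div n) * Q M + (1 - (1 - e) ^ (l div n)) * R M)"
    using minorization_decomp[OF A R e minor P'] by blast
  have "(A ^^ l) P = (A ^^ (l div n * n + l mod n)) P"
    by simp
  also have "\<dots> = (\<lambda>M. (1 - e) ^ (l div n) * Q M + (1 - (1 - e) ^ (l div n)) * R M)"
    unfolding funpow_add o_apply by (rule Q(2))
  finally have "(A ^^ l) P M - R M = (1 - e) ^ (l div n) * (Q M - R M)"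
    by (simp add: algebra_simps)
  moreover have "\<bar>Q M - R M\<bar> \<le> 1"
    using prob_vector_nonneg[OF Q(1), of M] prob_vector_le_1[OF Q(1), of M]
      prob_vector_nonneg[OF R(1), of M] prob_vector_le_1[OF R(1), of M] by linarith
  ultimately show ?thesis
    using e by (simp add: abs_mult mult_left_le)
qed

lemma minorization_tendsto:
  assumes A: "preserves_prob T A" "linear_op A" and R: "prob_vector T R" "A R = R"
    and e: "0 < e" "e < 1" and n: "n > 0"
    and minor: "\<And>P M. prob_vector T P \<Longrightarrow> e * R M \<le> (A ^^ n) P M"
    and P: "prob_vector T P"
  shows "(\<lambda>l. (A ^^ l) P M) \<longlonglongrightarrow> R M"
proof -
  have "filterlim (\<lambda>l. l div n) sequentially sequentially"
    unfolding filterlim_at_top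
  proof
    fix Z
    show "\<forall>\<^sub>F l in sequentially. Z \<le> l div n"
      using eventually_ge_at_top[of "Z * n"]
      by eventually_elim (use n in \<open>simp add: less_eq_div_iff_mult_less_eq\<close>)
  qed
  moreover have "(\<lambda>k. (1 - e) ^ k) \<longlonglongrightarrow> 0"
    using e by (intro LIMSEQ_realpow_zero) auto
  ultimately have "(\<lambda>l. (1 - e) ^ (l div n)) \<longlonglongrightarrow> 0"
    by (rule filterlim_compose[rotated])
  then have "(\<lambda>l. (A ^^ l) P M - R M) \<longlonglongrightarrow> 0"
    by (rule tendsto_0_le[where K = 1])
      (use e minorization_bound[OF A R e minor P] in simp)
  then show ?thesis by (simp add: LIM_zero_iff)
qed

section \<open>From local positivity to convergence\<close>

text \<open>The parity constraint makes \<open>\<bar>M - M'\<bar> \<le> 2\<close> mean equal or neighbouring in the sector.\<close>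

lemma local_positivity_spreads:
  assumes A: "preserves_prob T A"
    and c: "0 < c"
    and local: "\<And>P M M'. prob_vector T P \<Longrightarrow> M \<in> sector T \<Longrightarrow> M' \<in> sector T \<Longrightarrow> \<bar>M - M'\<bar> \<le> 2 \<Longrightarrow>
      c * P M' \<le> A P M"
    and P: "prob_vector T P"
  shows "M \<in> sector T \<Longrightarrow> M' \<in> sector T \<Longrightarrow> \<bar>M - M'\<bar> \<le> 2 * int d \<Longrightarrow> c ^ d * P M' \<le> (A ^^ d) P M"
proof (induction d arbitrary: M)
  case 0
  then show ?case by simp
next
  case (Suc d)
  \<comment> \<open>One sector step from \<open>M\<close> towards \<open>M'\<close>, or no move on
    arrival; the latter uses \<open>local\<close> at distance 0.\<close>
  define M'' where "M'' = (if M < M' then M + 2 else if M > M' then M - 2 else M)"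
  have M'': "M'' \<in> sector T" "\<bar>M - M''\<bar> \<le> 2" "\<bar>M'' - M'\<bar> \<le> 2 * int d"
    using Suc.prems sector_gap[of M T M'] sector_gap[of M' T M]
    by (auto simp: M''_def mem_sector_iff)
  have "c ^ Suc d * P M' \<le> c * (A ^^ d) P M''"
    using Suc.IH[OF M''(1) Suc.prems(2) M''(3)] c by (simp add: mult.assoc)
  also have "\<dots> \<le> (A ^^ Suc d) P M"
    using local[OF prob_vector_funpow[OF A P] Suc.prems(1) M''(1,2)] by simp
  finally show ?case .
qed

text \<open>Any two states of the sector differ by at most \<open>2 * int T\<close>, so
  \<open>Suc T\<close> local steps connect them, and the number of steps is positive even for
  \<open>T = 0\<close>.\<close>

lemma local_positivity_tendsto:
  assumes A: "preserves_prob T A" "linear_op A" and R: "prob_vector T R" "A R = R"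
    and c: "0 < c"
    and local: "\<And>P M M'. prob_vector T P \<Longrightarrow> M \<in> sector T \<Longrightarrow> M' \<in> sector T \<Longrightarrow> \<bar>M - M'\<bar> \<le> 2 \<Longrightarrow>
      c * P M' \<le> A P M"
    and P: "prob_vector T P"
  shows "(\<lambda>l. (A ^^ l) P M) \<longlonglongrightarrow> R M"
proof -
  \<comment> \<open>Summing the pointwise bound over the \<open>Suc T\<close> starting states
    \<open>M'\<close>, of total mass 1, gives the quotient; the minimum with 1/2 ensures
    \<open>e < 1\<close>.\<close>
  define e where "e = min (1/2) (c ^ Suc T / real (Suc T))"
  have e: "0 < e" "e < 1" using c by (auto simp: e_def)
  have minor: "e * R M \<le> (A ^^ Suc T) P M" if P: "prob_vector T P" for P M
  proof (cases "M \<in> sector T")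
    case True
    have "c ^ Suc T = (\<Sum>M'\<in>sector T. c ^ Suc T * P M')"
      by (simp add: prob_vector_sum[OF P] flip: sum_distrib_left)
    also have "\<dots> \<le> (\<Sum>M'\<in>sector T. (A ^^ Suc T) P M)"
    proof (rule sum_mono)
      fix M' assume "M' \<in> sector T"
      with True show "c ^ Suc T * P M' \<le> (A ^^ Suc T) P M"
        by (intro local_positivity_spreads[OF A(1) c local P]) (auto simp: mem_sector_iff)
    qed
    finally have "c ^ Suc T / real (Suc T) \<le> (A ^^ Suc T) P M"
      by (simp add: card_sector divide_le_eq mult.commute del: funpow.simps power_Suc of_nat_Suc)
    moreover have "e * R M \<le> e"
      using e prob_vector_le_1[OF R(1), of M] by (simp add: mult_left_le)
    ultimately show ?thesis unfolding e_def by linarith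
  next
    case False
    then show ?thesis
      using prob_vector_outside[OF R(1)] prob_vector_nonneg[OF prob_vector_funpow[OF A(1) P]]
      by (simp del: funpow.simps)
  qed
  show ?thesis
    by (rule minorization_tendsto[OF A R e zero_less_Suc minor P])
qed

text \<open>Iterating from a stationary vector gives a constant sequence, which must already equal
  the common limit \<open>R\<close>.\<close>

lemma ex1_stationary_if_tendsto:
  assumes "prob_vector T R" "A R = R"
    and lim: "\<And>P M. prob_vector T P \<Longrightarrow> (\<lambda>l. (A ^^ l) P M) \<longlonglongrightarrow> R M"
  shows "\<exists>!P. stationary A T P" "(THE P. stationary A T P) = R"
proof -
  have R: "stationary A T R"
    using assms by (simp add: stationary_def)
  have unique: "P = R" if "stationary A T P" for P
  proof
    fix M
    have "(A ^^ l) P = P" for l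
      using that by (simp add: stationary_def funpow_fixpoint)
    moreover have "(\<lambda>l. (A ^^ l) P M) \<longlonglongrightarrow> R M"
      using that lim by (simp add: stationary_def)
    ultimately show "P M = R M" by (simp add: LIMSEQ_const_iff)
  qed
  show "\<exists>!P. stationary A T P" using R unique by blast
  show "(THE P. stationary A T P) = R" using R unique by (rule the_equality)
qed

section \<open>Recycled quenching\<close>

lemma quench_local_positivity:
  assumes "T < N0"
  obtains c where "0 < c" "\<And>P M M'. prob_vector T P \<Longrightarrow> M' \<in> sector T \<Longrightarrow> \<bar>M - M'\<bar> = 1 \<Longrightarrow>
    c * P M' \<le> quench j N0 T P M"
proof -
  \<comment> \<open>The smallest of all up and down probabilities over the finite sector, positive
    because \<open>m_eq\<close> is strictly between -1 and 1.\<close>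
  define c where "c = Min ((\<lambda>M. (1 - \<bar>m_eq j N0 T M\<bar>) / 2) ` sector T)"
  have ne: "sector T \<noteq> {}" by (auto simp: sector_def)
  have "0 < c"
    unfolding c_def using ne abs_m_eq_less_1[OF assms] by (subst Min_gr_iff) auto
  moreover have "c * P M' \<le> quench j N0 T P M"
    if P: "prob_vector T P" and M: "M' \<in> sector T" "\<bar>M - M'\<bar> = 1" for P M M'
  proof -
    have m: "0 \<le> (1 + m_eq j N0 T M) / 2" "0 \<le> (1 - m_eq j N0 T M) / 2" for M
      using abs_m_eq_less_1[OF assms, of j M] by (simp_all add: abs_less_iff)
    have "c \<le> (1 - \<bar>m_eq j N0 T M'\<bar>) / 2"
      unfolding c_def using M(1) by (intro Min_le) auto
    then have c: "c \<le> (1 + m_eq j N0 T M') / 2" "c \<le> (1 - m_eq j N0 T M') / 2"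
      using abs_ge_self[of "m_eq j N0 T M'"] abs_ge_minus_self[of "m_eq j N0 T M'"]
      by (simp_all add: field_simps)
    note nn = prob_vector_nonneg[OF P]
    from M(2) consider "M' = M - 1" | "M' = M + 1" by linarith
    then show ?thesis
    proof cases
      case 1
      have "c * P M' \<le> P (M - 1) * ((1 + m_eq j N0 T (M - 1)) / 2)"
        using mult_left_mono[OF c(1) nn[of M']] by (simp add: 1 mult.commute)
      moreover have "0 \<le> P (M + 1) * ((1 - m_eq j N0 T (M + 1)) / 2)"
        using nn m by (intro mult_nonneg_nonneg)
      ultimately show ?thesis by (simp add: quench_def)
    next
      case 2
      have "c * P M' \<le> P (M + 1) * ((1 - m_eq j N0 T (M + 1)) / 2)"
        using mult_left_mono[OF c(2) nn[of M']] by (simp add: 2 mult.commute)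
      moreover have "0 \<le> P (M - 1) * ((1 + m_eq j N0 T (M - 1)) / 2)"
        using nn m by (intro mult_nonneg_nonneg)
      ultimately show ?thesis by (simp add: quench_def)
    qed
  qed
  ultimately show ?thesis by (rule that)
qed

text \<open>As the target \<open>M\<close> lies in the smaller sector, the source contains at least
  one spin of the sign to be released, and each spin is chosen with probability
  \<open>1 / real (Suc T)\<close>.\<close>

lemma unquench_local_positivity:
  assumes P: "prob_vector (Suc T) P" and M: "M \<in> sector T" "\<bar>M - M'\<bar> = 1"
  shows "1 / real (Suc T) * P M' \<le> unquench (Suc T) P M"
proof -
  let ?T = "real (Suc T)"
  let ?a = "1/2 * (1 + real_of_int (M + 1) / ?T)" and ?b = "1/2 * (1 - real_of_int (M - 1) / ?T)"
  have "- real T \<le> real_of_int M" "real_of_int M \<le> real T"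
    using M(1) unfolding mem_sector_iff by linarith+
  moreover have "?a = (real T + 2 + real_of_int M) / (2 * ?T)" "?b = (real T + 2 - real_of_int M) / (2 * ?T)"
    "1 / ?T = 2 / (2 * ?T)"
    by (simp_all add: field_simps)
  ultimately have ab: "1 / ?T \<le> ?a" "1 / ?T \<le> ?b"
    by (simp_all only: divide_right_mono)
  have "0 \<le> 1 / ?T" by simp
  then have ab0: "0 \<le> ?a" "0 \<le> ?b" using ab by linarith+
  note nn = prob_vector_nonneg[OF P]
  from M(2) consider "M' = M + 1" | "M' = M - 1" by linarith
  then show ?thesis
  proof cases
    case 1
    have "1 / ?T * P M' \<le> P (M + 1) * ?a"
      using mult_right_mono[OF ab(1) nn[of M']] by (simp only: 1 mult.commute)
    moreover have "0 \<le> P (M - 1) * ?b" using nn ab0(2) by (rule mult_nonneg_nonneg)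
    ultimately show ?thesis unfolding unquench_def by linarith
  next
    case 2
    have "1 / ?T * P M' \<le> P (M - 1) * ?b"
      using mult_right_mono[OF ab(2) nn[of M']] by (simp only: 2 mult.commute)
    moreover have "0 \<le> P (M + 1) * ?a" using nn ab0(1) by (rule mult_nonneg_nonneg)
    ultimately show ?thesis unfolding unquench_def by linarith
  qed
qed

lemma linear_op_quench: "linear_op (quench j N0 T)"
  unfolding linear_op_def quench_def by (intro allI ext) (simp add: algebra_simps add_divide_distrib diff_divide_distrib)

lemma linear_op_unquench: "linear_op (unquench T)"
  unfolding linear_op_def unquench_def by (intro allI ext) (simp add: algebra_simps add_divide_distrib diff_divide_distrib)

lemma linear_op_compose: "linear_op A \<Longrightarrow> linear_op B \<Longrightarrow> linear_op (\<lambda>P. A (B P))"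
  by (simp add: linear_op_def)

lemma KS_PQ: "T < N0 \<Longrightarrow> KS j N0 (Suc T) (PQ j N0 (Suc T)) = PQ j N0 (Suc T)"
  using unquench_PQ[of T N0 j] by (simp add: KS_def)

lemma SK_PQ: "T < N0 \<Longrightarrow> SK j N0 T (PQ j N0 T) = PQ j N0 T"
  using unquench_PQ[of T N0 j] by (simp add: SK_def)

lemma KS_tendsto:
  assumes T: "T < N0" and P: "prob_vector (Suc T) P"
  shows "(\<lambda>l. (KS j N0 (Suc T) ^^ l) P M) \<longlonglongrightarrow> PQ j N0 (Suc T) M"
proof -
  obtain c where c: "0 < c" "\<And>P M M'. prob_vector T P \<Longrightarrow> M' \<in> sector T \<Longrightarrow> \<bar>M - M'\<bar> = 1 \<Longrightarrow>
      c * P M' \<le> quench j N0 T P M"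
    using quench_local_positivity[OF T, of j] by blast
  have "preserves_prob (Suc T) (KS j N0 (Suc T))"
    by (simp add: preserves_prob_def KS_def prob_vector_quench[OF T] prob_vector_unquench)
  moreover have "linear_op (KS j N0 (Suc T))"
    using linear_op_compose[OF linear_op_quench linear_op_unquench, of j N0 T "Suc T"]
    by (simp add: KS_def[abs_def])
  moreover have "prob_vector (Suc T) (PQ j N0 (Suc T))"
    using T by (intro prob_vector_PQ) simp
  moreover note KS_PQ[OF T]
  moreover have "0 < c * (1 / real (Suc T))" using c by simp
  moreover have "c * (1 / real (Suc T)) * P M' \<le> KS j N0 (Suc T) P M"
    if P: "prob_vector (Suc T) P" and M: "M \<in> sector (Suc T)" "M' \<in> sector (Suc T)" "\<bar>M - M'\<bar> \<le> 2"
    for P M M'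
  proof -
    obtain M'' where M'': "M'' \<in> sector T" "\<bar>M - M''\<bar> = 1" "\<bar>M'' - M'\<bar> = 1"
    proof -
      \<comment> \<open>The intermediate state must lie in the smaller sector. For
        \<open>M = M'\<close> it is taken towards 0 when \<open>M\<close> is nonzero, since an
        extreme \<open>M\<close> has only that neighbour there.\<close>
      define M'' where "M'' = (if M < M' then M + 1 else if M > M' then M - 1 else if M > 0 then M - 1 else M + 1)"
      have "\<bar>M - M''\<bar> = 1" "\<bar>M'' - M'\<bar> = 1"
        using M sector_gap[of M "Suc T" M'] sector_gap[of M' "Suc T" M] by (auto simp: M''_def)
      moreover have "even (M'' + int T)"
        using M(1) by (auto simp: M''_def mem_sector_iff)
      \<comment> \<open>If \<open>M = 0\<close>, parity makes \<open>T\<close> odd, so the choice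
        \<open>M'' = 1\<close> is admissible.\<close>
      moreover have "M = 0 \<Longrightarrow> 1 \<le> int T"
        using M(1) odd_pos[of T] by (auto simp: mem_sector_iff)
      then have "\<bar>M''\<bar> \<le> int T"
        using M(1,2) sector_gap[OF M(1,2)] sector_gap[OF M(2,1)] unfolding M''_def mem_sector_iff
        by (smt (verit) of_nat_Suc)
      ultimately show ?thesis using that by (simp add: mem_sector_iff)
    qed
    have "c * (1 / real (Suc T) * P M') \<le> c * unquench (Suc T) P M''"
      using unquench_local_positivity[OF P M''(1,3)] c(1) by (intro mult_left_mono) auto
    also have "\<dots> \<le> KS j N0 (Suc T) P M"
      using c(2)[OF prob_vector_unquench[OF P] M''(1,2)] by (simp add: KS_def)
    finally show ?thesis by (simp only: mult.assoc)
  qed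
  ultimately show ?thesis
    using P by (rule local_positivity_tendsto)
qed

lemma SK_tendsto:
  assumes T: "T < N0" and P: "prob_vector T P"
  shows "(\<lambda>l. (SK j N0 T ^^ l) P M) \<longlonglongrightarrow> PQ j N0 T M"
proof -
  obtain c where c: "0 < c" "\<And>P M M'. prob_vector T P \<Longrightarrow> M' \<in> sector T \<Longrightarrow> \<bar>M - M'\<bar> = 1 \<Longrightarrow>
      c * P M' \<le> quench j N0 T P M"
    using quench_local_positivity[OF T, of j] by blast
  have "preserves_prob T (SK j N0 T)"
    by (simp add: preserves_prob_def SK_def prob_vector_quench[OF T] prob_vector_unquench)
  moreover have "linear_op (SK j N0 T)"
    using linear_op_compose[OF linear_op_unquench linear_op_quench, of "Suc T" j N0 T]
    by (simp add: SK_def[abs_def])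
  moreover have "prob_vector T (PQ j N0 T)"
    using T by (intro prob_vector_PQ) simp
  moreover note SK_PQ[OF T]
  moreover have "0 < 1 / real (Suc T) * c" using c by simp
  moreover have "1 / real (Suc T) * c * P M' \<le> SK j N0 T P M"
    if P: "prob_vector T P" and M: "M \<in> sector T" "M' \<in> sector T" "\<bar>M - M'\<bar> \<le> 2"
    for P M M'
  proof -
    \<comment> \<open>The intermediate state now lies in the larger sector, which contains both
      neighbours of \<open>M\<close>, so the boundary needs no separate case.\<close>
    define M'' where "M'' = (if M < M' then M + 1 else if M > M' then M - 1 else M + 1)"
    have M'': "\<bar>M - M''\<bar> = 1" "\<bar>M'' - M'\<bar> = 1"
      using M sector_gap[of M T M'] sector_gap[of M' T M] by (auto simp: M''_def)
    have "1 / real (Suc T) * (c * P M') \<le> 1 / real (Suc T) * quench j N0 T P M''"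
      using c(2)[OF P M(2) M''(2)] by (intro mult_left_mono) auto
    also have "\<dots> \<le> SK j N0 T P M"
      using unquench_local_positivity[OF prob_vector_quench[OF T P] M(1) M''(1)] by (simp add: SK_def)
    finally show ?thesis by (simp only: mult.assoc)
  qed
  ultimately show ?thesis
    using P by (rule local_positivity_tendsto)
qed

section \<open>Uniqueness and identification with progressive quenching\<close>

lemma KS_stationary:
  assumes "T < N0"
  shows "\<exists>!P. stationary (KS j N0 (Suc T)) (Suc T) P" "P_inf j N0 (Suc T) = PQ j N0 (Suc T)"
  using ex1_stationary_if_tendsto[OF prob_vector_PQ[OF Suc_leI] KS_PQ KS_tendsto, OF assms assms assms]
  by (simp_all add: P_inf_def)

lemma SK_stationary:
  assumes "T < N0"
  shows "\<exists>!Q. stationary (SK j N0 T) T Q" "Q_inf j N0 T = PQ j N0 T"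
  using ex1_stationary_if_tendsto[OF prob_vector_PQ[OF less_imp_le] SK_PQ SK_tendsto, OF assms assms assms]
  by (simp_all add: Q_inf_def)

text \<open>Includes the conventional value at \<open>T = 0\<close>, which the operator relations at
  \<open>T = 1\<close> refer to.\<close>

lemma P_inf_eq_PQ: "T \<le> N0 \<Longrightarrow> P_inf j N0 T = PQ j N0 T"
  using KS_stationary(2)[of "T - 1" N0 j] by (cases "T = 0") (auto simp: P_inf_def)

theorem mainTheorem3:
  fixes N0 :: nat and j :: real
  assumes "N0 \<ge> 1" and "j > 0"
  shows
    "(\<forall>T. 1 \<le> T \<and> T \<le> N0 \<longrightarrow>
        (\<exists>!P. stationary (KS j N0 T) T P) \<and>
        (\<forall>P. prob_vector T P \<longrightarrow>
           (\<forall>M. (\<lambda>l. ((KS j N0 T) ^^ l) P M) \<longlonglongrightarrow> P_inf j N0 T M))) \<and>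
     (\<forall>T. T \<le> N0 - 1 \<longrightarrow>
        (\<exists>!Q. stationary (SK j N0 T) T Q) \<and>
        (\<forall>Q. prob_vector T Q \<longrightarrow>
           (\<forall>M. (\<lambda>l. ((SK j N0 T) ^^ l) Q M) \<longlonglongrightarrow> Q_inf j N0 T M))) \<and>
     (\<forall>T. 1 \<le> T \<and> T \<le> N0 \<longrightarrow> P_inf j N0 T = PQ j N0 T) \<and>
     (\<forall>T. T \<le> N0 - 1 \<longrightarrow> Q_inf j N0 T = PQ j N0 T) \<and>
     (\<forall>T. 1 \<le> T \<and> T \<le> N0 \<longrightarrow>
        quench j N0 (T - 1) (P_inf j N0 (T - 1)) = P_inf j N0 T \<and>
        unquench T (P_inf j N0 T) = P_inf j N0 (T - 1))"
proof (intro conjI allI impI; (elim conjE)?)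
  fix T
  assume "1 \<le> T" "T \<le> N0"
  then obtain T' where T: "T = Suc T'" "T' < N0" by (cases T) auto
  show "\<exists>!P. stationary (KS j N0 T) T P"
    unfolding T(1) by (rule KS_stationary(1)[OF T(2)])
  show "(\<lambda>l. ((KS j N0 T) ^^ l) P M) \<longlonglongrightarrow> P_inf j N0 T M" if "prob_vector T P" for P M
    using KS_tendsto[OF T(2)] that unfolding T(1) KS_stationary(2)[OF T(2)] by blast
  show "P_inf j N0 T = PQ j N0 T"
    unfolding T(1) by (rule KS_stationary(2)[OF T(2)])
  \<comment> \<open>With \<open>P_inf\<close> replaced by \<open>PQ\<close>, the first relation is
    the defining recursion of \<open>PQ\<close> and the second is
    \<open>unquench_PQ\<close>.\<close>
  show "quench j N0 (T - 1) (P_inf j N0 (T - 1)) = P_inf j N0 T"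
    "unquench T (P_inf j N0 T) = P_inf j N0 (T - 1)"
    using T(2) unquench_PQ[OF T(2), of j] by (simp_all add: T(1) P_inf_eq_PQ)
next
  fix T
  assume "T \<le> N0 - 1"
  then have T: "T < N0" using assms(1) by simp
  show "\<exists>!Q. stationary (SK j N0 T) T Q" "Q_inf j N0 T = PQ j N0 T"
    by (rule SK_stationary[OF T])+
  show "(\<lambda>l. ((SK j N0 T) ^^ l) Q M) \<longlonglongrightarrow> Q_inf j N0 T M" if "prob_vector T Q" for Q M
    unfolding SK_stationary(2)[OF T] by (rule SK_tendsto[OF T that])
qed

end
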